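(* Let $k$ be a field, $H$ a bialgebra over $k$ with an idempotent element $e$ (that is, $e^2=e$), and $M$ a left, right $H$-dimodule. Define $T:M\to M$ by $T(m)=e\cdot m$. Then $(M,T)$ is a generic Rota-Baxter paired (right) $H$-comodule of weight $-1$.
   Context: All spaces, maps and tensor products are over $k$. Right coactions are written $\rho(m)=m_{[0]}\otimes m_{[1]}\in M\otimes H$. A left, right $H$-dimodule is a $k$-module $M$ that is both a left $H$-module and a right $H$-comodule such that $\rho(h\cdot m)=h\cdot m_{[0]}\otimes m_{[1]}$ for all $h\in H$, $m\in M$. For a right $H$-comodule $M$ and linear maps $P:H\to H$, $T:M\to M$, the triple $(M,P,T)$ is a Rota-Baxter paired (right) $H$-comodule of weight $\lambda\in k$ if $(T\otimes P)\rho=(\mathrm{id}\otimes P)\rho T+(T\otimes\mathrm{id})\rho T+\lambda\rho T$. $(M,T)$ is a generic Rota-Baxter paired (right) $H$-comodule of weight $\lambda$ if $(M,P,T)$ is one for every linear map $P:H\to H$. *)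

theory Defs
  imports "HOL-Algebra.Free_Abelian_Groups" "Jordan_Normal_Form.Missing_VectorSpace"
begin

section \<open>Tensor products over a commutative ring\<close>

text \<open>
  The tensor product of \<open>R\<close>-modules \<open>A\<close> and \<open>B\<close> is the free abelian group on
  \<open>carrier A \<times> carrier B\<close> modulo the subgroup that makes \<open>(a, b) \<mapsto> a \<otimes> b\<close> biadditive and
  \<open>R\<close>-balanced. Its elements are cosets.
\<close>

type_synonym ('a, 'b) tensor = "(('a \<times> 'b) \<Rightarrow>\<^sub>0 int) set"

definition tensor_relators ::
    "('k, 'r) ring_scheme \<Rightarrow> ('k, 'a, 'u) module_scheme \<Rightarrow> ('k, 'b, 'v) module_scheme \<Rightarrow>
     ('a, 'b) tensor" where
  "tensor_relators R A B =
     {frag_of (a \<oplus>\<^bsub>A\<^esub> a', b) - frag_of (a, b) - frag_of (a', b) | a a' b.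
        a \<in> carrier A \<and> a' \<in> carrier A \<and> b \<in> carrier B} \<union>
     {frag_of (a, b \<oplus>\<^bsub>B\<^esub> b') - frag_of (a, b) - frag_of (a, b') | a b b'.
        a \<in> carrier A \<and> b \<in> carrier B \<and> b' \<in> carrier B} \<union>
     {frag_of (r \<odot>\<^bsub>A\<^esub> a, b) - frag_of (a, r \<odot>\<^bsub>B\<^esub> b) | r a b.
        r \<in> carrier R \<and> a \<in> carrier A \<and> b \<in> carrier B}"

abbreviation tensor_free ::
    "('k, 'a, 'u) module_scheme \<Rightarrow> ('k, 'b, 'v) module_scheme \<Rightarrow> (('a \<times> 'b) \<Rightarrow>\<^sub>0 int) monoid" where
  "tensor_free A B \<equiv> free_Abelian_group (carrier A \<times> carrier B)"

definition tensor_subgroup ::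
    "('k, 'r) ring_scheme \<Rightarrow> ('k, 'a, 'u) module_scheme \<Rightarrow> ('k, 'b, 'v) module_scheme \<Rightarrow>
     ('a, 'b) tensor" where
  "tensor_subgroup R A B = generate (tensor_free A B) (tensor_relators R A B)"

definition tensor_group ::
    "('k, 'r) ring_scheme \<Rightarrow> ('k, 'a, 'u) module_scheme \<Rightarrow> ('k, 'b, 'v) module_scheme \<Rightarrow>
     ('a, 'b) tensor monoid" where
  "tensor_group R A B = tensor_free A B Mod tensor_subgroup R A B"

definition pure_tensor ::
    "('k, 'r) ring_scheme \<Rightarrow> ('k, 'a, 'u) module_scheme \<Rightarrow> ('k, 'b, 'v) module_scheme \<Rightarrow>
     'a \<Rightarrow> 'b \<Rightarrow> ('a, 'b) tensor" where
  "pure_tensor R A B a b = tensor_subgroup R A B #>\<^bsub>tensor_free A B\<^esub> frag_of (a, b)"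

text \<open>
  The additive map on the tensor product induced by \<open>a \<otimes> b \<mapsto> f a b\<close>. It exists, and is unique,
  whenever \<open>f\<close> is balanced: see \<open>tensor_lift_hom\<close> and \<open>tensor_lift_pure\<close> below. The target \<open>G\<close> is
  the (multiplicatively written) additive group of a module.
\<close>

definition tensor_lift ::
    "('k, 'r) ring_scheme \<Rightarrow> ('k, 'a, 'u) module_scheme \<Rightarrow> ('k, 'b, 'v) module_scheme \<Rightarrow>
     ('c, 'w) monoid_scheme \<Rightarrow> ('a \<Rightarrow> 'b \<Rightarrow> 'c) \<Rightarrow> ('a, 'b) tensor \<Rightarrow> 'c" where
  "tensor_lift R A B G f =
     (THE g. g \<in> extensional (carrier (tensor_group R A B)) \<and> g \<in> hom (tensor_group R A B) G \<and>
        (\<forall>a\<in>carrier A. \<forall>b\<in>carrier B. g (pure_tensor R A B a b) = f a b))"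

lemma tensor_relators_in_carrier:
  assumes "module R A" and "module R B"
  shows "tensor_relators R A B \<subseteq> carrier (tensor_free A B)"
proof -
  interpret A: module R A by fact
  interpret B: module R B by fact
  have 1: "Poly_Mapping.keys (frag_of p - frag_of q - frag_of r) \<subseteq> {p, q, r}" for p q r :: "'x \<times> 'y"
    using keys_diff[of "frag_of p - frag_of q" "frag_of r"] keys_diff[of "frag_of p" "frag_of q"]
    by auto
  have 2: "Poly_Mapping.keys (frag_of p - frag_of q) \<subseteq> {p, q}" for p q :: "'x \<times> 'y"
    using keys_diff[of "frag_of p" "frag_of q"] by auto
  show ?thesis
    unfolding tensor_relators_def
    by (auto dest!: subsetD[OF 1] subsetD[OF 2])
qed

lemma tensor_subgroup_normal:
  assumes "module R A" and "module R B"
  shows "tensor_subgroup R A B \<lhd> tensor_free A B"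
proof -
  interpret F: comm_group "tensor_free A B" by (rule abelian_free_Abelian_group)
  show ?thesis
    unfolding tensor_subgroup_def
    by (intro F.subgroup_imp_normal F.generate_is_subgroup tensor_relators_in_carrier assms)
qed

lemma tensor_group_comm_group:
  assumes "module R A" and "module R B"
  shows "comm_group (tensor_group R A B)"
proof -
  interpret F: comm_group "tensor_free A B" by (rule abelian_free_Abelian_group)
  show ?thesis
    unfolding tensor_group_def
    using F.abelian_FactGroup tensor_subgroup_normal[OF assms] normal_imp_subgroup by blast
qed

lemma pure_tensor_closed:
  assumes "module R A" and "module R B" and "a \<in> carrier A" and "b \<in> carrier B"
  shows "pure_tensor R A B a b \<in> carrier (tensor_group R A B)"
  unfolding pure_tensor_def tensor_group_def FactGroup_def RCOSETS_def using assms(3,4) by auto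

lemma free_Abelian_group_hom_diff:
  assumes h: "h \<in> hom (free_Abelian_group S) G" and "group G"
    and a: "Poly_Mapping.keys a \<subseteq> S" and b: "Poly_Mapping.keys b \<subseteq> S"
  shows "h (a - b) = h a \<otimes>\<^bsub>G\<^esub> inv\<^bsub>G\<^esub> h b"
proof -
  interpret h: group_hom "free_Abelian_group S" G h
    using h \<open>group G\<close> by (simp add: group_hom_def group_hom_axioms_def)
  have "Poly_Mapping.keys (a - b) \<subseteq> S" using a b keys_diff[of a b] by blast
  moreover have "h (a - b + b) = h (a - b) \<otimes>\<^bsub>G\<^esub> h b"
    using calculation b h.hom_mult[of "a - b" b] by simp
  moreover have "h (a - b) \<in> carrier G" "h a \<in> carrier G" "h b \<in> carrier G"
    using calculation(1) a b by (auto intro!: h.hom_closed)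
  ultimately show ?thesis by (simp add: h.H.inv_solve_right)
qed

lemma tensor_hom_unique:
  assumes AB: "module R A" "module R B" and "group G"
    and g: "g \<in> hom (tensor_group R A B) G" and h: "h \<in> hom (tensor_group R A B) G"
    and eq: "\<And>a b. \<lbrakk>a \<in> carrier A; b \<in> carrier B\<rbrakk> \<Longrightarrow>
      g (pure_tensor R A B a b) = h (pure_tensor R A B a b)"
    and t: "t \<in> carrier (tensor_group R A B)"
  shows "g t = h t"
proof -
  interpret F: comm_group "tensor_free A B" by (rule abelian_free_Abelian_group)
  interpret N: normal "tensor_subgroup R A B" "tensor_free A B" by (rule tensor_subgroup_normal[OF AB])
  let ?q = "\<lambda>x. tensor_subgroup R A B #>\<^bsub>tensor_free A B\<^esub> x"
  have q: "?q \<in> hom (tensor_free A B) (tensor_group R A B)"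
    unfolding tensor_group_def by (rule N.r_coset_hom_Mod)
  obtain x where x: "x \<in> carrier (tensor_free A B)" "t = ?q x"
    using t unfolding tensor_group_def FactGroup_def RCOSETS_def by auto
  have gq: "g \<circ> ?q \<in> hom (tensor_free A B) G" and hq: "h \<circ> ?q \<in> hom (tensor_free A B) G"
    using Group.hom_compose q g h by blast+
  have "Poly_Mapping.keys x \<subseteq> carrier A \<times> carrier B" using x(1) by simp
  then have "Poly_Mapping.keys x \<subseteq> carrier A \<times> carrier B \<and> (g \<circ> ?q) x = (h \<circ> ?q) x"
  proof (induction x rule: frag_induction)
    case zero
    interpret gq: group_hom "tensor_free A B" G "g \<circ> ?q"
      using gq \<open>group G\<close> by (simp add: group_hom_def group_hom_axioms_def)
    interpret hq: group_hom "tensor_free A B" G "h \<circ> ?q"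
      using hq \<open>group G\<close> by (simp add: group_hom_def group_hom_axioms_def)
    show ?case using gq.hom_one hq.hom_one by (simp only: one_free_Abelian_group keys_zero) simp
  next
    case (one p)
    then show ?case using eq by (cases p) (auto simp: pure_tensor_def)
  next
    case (diff a b)
    have "Poly_Mapping.keys (a - b) \<subseteq> carrier A \<times> carrier B"
      using diff keys_diff[of a b] by blast
    then show ?case
      using diff free_Abelian_group_hom_diff[OF gq \<open>group G\<close>]
        free_Abelian_group_hom_diff[OF hq \<open>group G\<close>] by simp
  qed
  then show ?thesis using x(2) by simp
qed

context
  fixes R :: "('k, 'r) ring_scheme" and A :: "('k, 'a, 'u) module_scheme"
    and B :: "('k, 'b, 'v) module_scheme" and G :: "('c, 'w) monoid_scheme"
    and f :: "'a \<Rightarrow> 'b \<Rightarrow> 'c"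
  assumes AB: "module R A" "module R B" and G: "comm_group G"
    and closed: "\<And>a b. \<lbrakk>a \<in> carrier A; b \<in> carrier B\<rbrakk> \<Longrightarrow> f a b \<in> carrier G"
    and add_left: "\<And>a a' b. \<lbrakk>a \<in> carrier A; a' \<in> carrier A; b \<in> carrier B\<rbrakk> \<Longrightarrow>
      f (a \<oplus>\<^bsub>A\<^esub> a') b = f a b \<otimes>\<^bsub>G\<^esub> f a' b"
    and add_right: "\<And>a b b'. \<lbrakk>a \<in> carrier A; b \<in> carrier B; b' \<in> carrier B\<rbrakk> \<Longrightarrow>
      f a (b \<oplus>\<^bsub>B\<^esub> b') = f a b \<otimes>\<^bsub>G\<^esub> f a b'"
    and balanced: "\<And>r a b. \<lbrakk>r \<in> carrier R; a \<in> carrier A; b \<in> carrier B\<rbrakk> \<Longrightarrow>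
      f (r \<odot>\<^bsub>A\<^esub> a) b = f a (r \<odot>\<^bsub>B\<^esub> b)"
begin

lemma tensor_lift_ex1:
  "\<exists>!g. g \<in> extensional (carrier (tensor_group R A B)) \<and> g \<in> hom (tensor_group R A B) G \<and>
     (\<forall>a\<in>carrier A. \<forall>b\<in>carrier B. g (pure_tensor R A B a b) = f a b)"
proof -
  interpret A: module R A by fact
  interpret B: module R B by fact
  interpret G: comm_group G by fact
  interpret F: comm_group "tensor_free A B" by (rule abelian_free_Abelian_group)
  have "case_prod f ` (carrier A \<times> carrier B) \<subseteq> carrier G" using closed by auto
  then obtain h where h: "h \<in> hom (tensor_free A B) G"
    and hf: "\<And>a b. \<lbrakk>a \<in> carrier A; b \<in> carrier B\<rbrakk> \<Longrightarrow> h (frag_of (a, b)) = f a b"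
    by (rule G.free_Abelian_group_universal) auto
  interpret h: group_hom "tensor_free A B" G h
    using h by unfold_locales
  have hd2: "h (frag_of (a, b) - frag_of (c, d)) = f a b \<otimes>\<^bsub>G\<^esub> inv\<^bsub>G\<^esub> f c d"
    if "a \<in> carrier A" "b \<in> carrier B" "c \<in> carrier A" "d \<in> carrier B" for a b c d
    using that free_Abelian_group_hom_diff[OF h G.is_group] by (simp add: hf)
  have hd3: "h (frag_of (a, b) - frag_of (c, d) - frag_of (a', b')) =
      f a b \<otimes>\<^bsub>G\<^esub> inv\<^bsub>G\<^esub> f c d \<otimes>\<^bsub>G\<^esub> inv\<^bsub>G\<^esub> f a' b'"
    if "a \<in> carrier A" "b \<in> carrier B" "c \<in> carrier A" "d \<in> carrier B"
      "a' \<in> carrier A" "b' \<in> carrier B" for a b c d a' b'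
  proof -
    have "Poly_Mapping.keys (frag_of (a, b) - frag_of (c, d)) \<subseteq> carrier A \<times> carrier B"
      using that keys_diff[of "frag_of (a, b)" "frag_of (c, d)"] by auto
    then show ?thesis using that free_Abelian_group_hom_diff[OF h G.is_group] by (simp add: hf hd2)
  qed
  have canc: "x \<otimes>\<^bsub>G\<^esub> y \<otimes>\<^bsub>G\<^esub> inv\<^bsub>G\<^esub> x \<otimes>\<^bsub>G\<^esub> inv\<^bsub>G\<^esub> y = \<one>\<^bsub>G\<^esub>"
    if "x \<in> carrier G" "y \<in> carrier G" for x y
  proof -
    have "x \<otimes>\<^bsub>G\<^esub> y \<otimes>\<^bsub>G\<^esub> inv\<^bsub>G\<^esub> x \<otimes>\<^bsub>G\<^esub> inv\<^bsub>G\<^esub> y =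
        (x \<otimes>\<^bsub>G\<^esub> y) \<otimes>\<^bsub>G\<^esub> (inv\<^bsub>G\<^esub> x \<otimes>\<^bsub>G\<^esub> inv\<^bsub>G\<^esub> y)"
      using that by (intro G.m_assoc) auto
    also have "\<dots> = (x \<otimes>\<^bsub>G\<^esub> y) \<otimes>\<^bsub>G\<^esub> inv\<^bsub>G\<^esub> (x \<otimes>\<^bsub>G\<^esub> y)"
      using that by (simp only: G.inv_mult)
    also have "\<dots> = \<one>\<^bsub>G\<^esub>" using that by (intro G.r_inv G.m_closed)
    finally show ?thesis .
  qed
  have "h x = \<one>\<^bsub>G\<^esub>" if x: "x \<in> tensor_relators R A B" for x
    using x unfolding tensor_relators_def
    by (elim UnE CollectE exE conjE)
      (simp_all add: hd2 hd3 add_left add_right balanced canc closed)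
  then have "tensor_relators R A B \<subseteq> kernel (tensor_free A B) G h"
    using tensor_relators_in_carrier[OF AB] unfolding kernel_def by blast
  then have ker: "tensor_subgroup R A B \<subseteq> kernel (tensor_free A B) G h"
    unfolding tensor_subgroup_def by (rule F.generate_subgroup_incl[OF _ h.subgroup_kernel])
  obtain g where g: "g \<in> hom (tensor_group R A B) G"
    and gh: "\<And>x. x \<in> carrier (tensor_free A B) \<Longrightarrow>
      g (tensor_subgroup R A B #>\<^bsub>tensor_free A B\<^esub> x) = h x"
    by (rule h.FactGroup_universal_kernel[OF tensor_subgroup_normal[OF AB] ker,
          folded tensor_group_def]) blast
  have gf: "g (pure_tensor R A B a b) = f a b" if "a \<in> carrier A" "b \<in> carrier B" for a b
    using that gh hf by (simp add: pure_tensor_def)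
  interpret T: comm_group "tensor_group R A B" by (rule tensor_group_comm_group[OF AB])
  show ?thesis
  proof (rule ex1I[of _ "restrict g (carrier (tensor_group R A B))"], goal_cases)
    case 1
    show ?case using g gf by (auto simp: hom_def pure_tensor_closed[OF AB])
  next
    case (2 g')
    show ?case
    proof (rule extensionalityI)
      fix t assume t: "t \<in> carrier (tensor_group R A B)"
      have "g' t = g t"
        by (rule tensor_hom_unique[OF AB G.is_group _ g _ t]) (use 2 gf in simp_all)
      then show "g' t = restrict g (carrier (tensor_group R A B)) t" using t by simp
    qed (use 2 in auto)
  qed
qed

lemma tensor_lift_hom: "tensor_lift R A B G f \<in> hom (tensor_group R A B) G"
  using theI'[OF tensor_lift_ex1] unfolding tensor_lift_def by blast

lemma tensor_lift_pure:
  "\<lbrakk>a \<in> carrier A; b \<in> carrier B\<rbrakk> \<Longrightarrow> tensor_lift R A B G f (pure_tensor R A B a b) = f a b"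
  using theI'[OF tensor_lift_ex1] unfolding tensor_lift_def by blast

end

text \<open>
  The module \<open>A \<otimes> B\<close>. Its \<open>mult\<close> and \<open>one\<close> fields are those of the tensor product of algebras,
  \<open>(a \<otimes> b)(c \<otimes> d) = ac \<otimes> bd\<close>; they carry no meaning unless \<open>A\<close> and \<open>B\<close> are algebras.
\<close>

definition tensor_product ::
    "('k, 'r) ring_scheme \<Rightarrow> ('k, 'a, 'u) module_scheme \<Rightarrow> ('k, 'b, 'v) module_scheme \<Rightarrow>
     ('k, ('a, 'b) tensor) module" where
  "tensor_product R A B =
     \<lparr>carrier = carrier (tensor_group R A B),
      monoid.mult = (\<lambda>s t. tensor_lift R A B (tensor_group R A B)
                (\<lambda>a b. tensor_lift R A B (tensor_group R A B)
                   (\<lambda>c d. pure_tensor R A B (a \<otimes>\<^bsub>A\<^esub> c) (b \<otimes>\<^bsub>B\<^esub> d)) t) s),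
      one = pure_tensor R A B \<one>\<^bsub>A\<^esub> \<one>\<^bsub>B\<^esub>,
      ring.zero = \<one>\<^bsub>tensor_group R A B\<^esub>,
      add = (\<otimes>\<^bsub>tensor_group R A B\<^esub>),
      smult = (\<lambda>r. tensor_lift R A B (tensor_group R A B)
                (\<lambda>a b. pure_tensor R A B (r \<odot>\<^bsub>A\<^esub> a) b))\<rparr>"

text \<open>\<open>tensor_map R A B A' B' f g\<close> is \<open>f \<otimes> g : A \<otimes> B \<rightarrow> A' \<otimes> B'\<close>.\<close>

definition tensor_map ::
    "('k, 'r) ring_scheme \<Rightarrow> ('k, 'a, 'u) module_scheme \<Rightarrow> ('k, 'b, 'v) module_scheme \<Rightarrow>
     ('k, 'c, 'w) module_scheme \<Rightarrow> ('k, 'd, 'x) module_scheme \<Rightarrow>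
     ('a \<Rightarrow> 'c) \<Rightarrow> ('b \<Rightarrow> 'd) \<Rightarrow> ('a, 'b) tensor \<Rightarrow> ('c, 'd) tensor" where
  "tensor_map R A B A' B' f g =
     tensor_lift R A B (tensor_group R A' B') (\<lambda>a b. pure_tensor R A' B' (f a) (g b))"

text \<open>The canonical map \<open>(A \<otimes> B) \<otimes> C \<rightarrow> A \<otimes> (B \<otimes> C)\<close>.\<close>

definition tensor_assoc ::
    "('k, 'r) ring_scheme \<Rightarrow> ('k, 'a, 'u) module_scheme \<Rightarrow> ('k, 'b, 'v) module_scheme \<Rightarrow>
     ('k, 'c, 'w) module_scheme \<Rightarrow> (('a, 'b) tensor, 'c) tensor \<Rightarrow> ('a, ('b, 'c) tensor) tensor" where
  "tensor_assoc R A B C =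
     (let G = tensor_group R A (tensor_product R B C) in
      tensor_lift R (tensor_product R A B) C G
        (\<lambda>t c. tensor_lift R A B G
           (\<lambda>a b. pure_tensor R A (tensor_product R B C) a (pure_tensor R B C b c)) t))"

definition base_module :: "('k, 'r) ring_scheme \<Rightarrow> ('k, 'k) module" where
  "base_module R =
     \<lparr>carrier = carrier R, monoid.mult = (\<otimes>\<^bsub>R\<^esub>), one = \<one>\<^bsub>R\<^esub>, ring.zero = \<zero>\<^bsub>R\<^esub>, add = (\<oplus>\<^bsub>R\<^esub>),
      smult = (\<otimes>\<^bsub>R\<^esub>)\<rparr>"


section \<open>Bialgebras, modules, comodules and dimodules\<close>

text \<open>Associative unital algebras; the library's locale \<open>algebra\<close> requires commutativity.\<close>

locale assoc_algebra = module R A + ring A for R (structure) and A (structure) +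
  assumes smult_mult_left:
      "\<lbrakk>r \<in> carrier R; x \<in> carrier A; y \<in> carrier A\<rbrakk> \<Longrightarrow>
       (r \<odot>\<^bsub>A\<^esub> x) \<otimes>\<^bsub>A\<^esub> y = r \<odot>\<^bsub>A\<^esub> (x \<otimes>\<^bsub>A\<^esub> y)"
    and smult_mult_right:
      "\<lbrakk>r \<in> carrier R; x \<in> carrier A; y \<in> carrier A\<rbrakk> \<Longrightarrow>
       x \<otimes>\<^bsub>A\<^esub> (r \<odot>\<^bsub>A\<^esub> y) = r \<odot>\<^bsub>A\<^esub> (x \<otimes>\<^bsub>A\<^esub> y)"

locale coalgebra = module R C for R (structure) and C (structure) +
  fixes \<Delta> :: "'c \<Rightarrow> ('c, 'c) tensor" and \<epsilon> :: "'c \<Rightarrow> 'a"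
  assumes comult_linear: "\<Delta> \<in> module_hom R C (tensor_product R C C)"
    and counit_linear: "\<epsilon> \<in> module_hom R C (base_module R)"
    and coassoc: "c \<in> carrier C \<Longrightarrow>
      tensor_assoc R C C C (tensor_map R C C (tensor_product R C C) C \<Delta> id (\<Delta> c)) =
      tensor_map R C C C (tensor_product R C C) id \<Delta> (\<Delta> c)"
    and counit_left: "c \<in> carrier C \<Longrightarrow>
      tensor_lift R C C (add_monoid C) (\<lambda>x y. \<epsilon> x \<odot>\<^bsub>C\<^esub> y) (\<Delta> c) = c"
    and counit_right: "c \<in> carrier C \<Longrightarrow>
      tensor_lift R C C (add_monoid C) (\<lambda>x y. \<epsilon> y \<odot>\<^bsub>C\<^esub> x) (\<Delta> c) = c"

locale bialgebra = assoc_algebra R H + coalgebra R H \<Delta> \<epsilon>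
  for R (structure) and H (structure) and \<Delta> and \<epsilon> +
  assumes comult_alg_hom: "\<Delta> \<in> ring_hom H (tensor_product R H H)"
    and counit_alg_hom: "\<epsilon> \<in> ring_hom H R"

locale left_module = assoc_algebra R H + M: module R M
  for R (structure) and H (structure) and M (structure) +
  fixes act :: "'h \<Rightarrow> 'm \<Rightarrow> 'm"  (infixr \<open>\<triangleright>\<close> 75)
  constrains H :: "('a, 'h, 'u) module_scheme" and M :: "('a, 'm, 'v) module_scheme"
  assumes act_closed: "\<lbrakk>h \<in> carrier H; m \<in> carrier M\<rbrakk> \<Longrightarrow> h \<triangleright> m \<in> carrier M"
    and act_add_left: "\<lbrakk>h \<in> carrier H; h' \<in> carrier H; m \<in> carrier M\<rbrakk> \<Longrightarrow>
      (h \<oplus>\<^bsub>H\<^esub> h') \<triangleright> m = h \<triangleright> m \<oplus>\<^bsub>M\<^esub> h' \<triangleright> m"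
    and act_add_right: "\<lbrakk>h \<in> carrier H; m \<in> carrier M; m' \<in> carrier M\<rbrakk> \<Longrightarrow>
      h \<triangleright> (m \<oplus>\<^bsub>M\<^esub> m') = h \<triangleright> m \<oplus>\<^bsub>M\<^esub> h \<triangleright> m'"
    and act_smult_left: "\<lbrakk>r \<in> carrier R; h \<in> carrier H; m \<in> carrier M\<rbrakk> \<Longrightarrow>
      (r \<odot>\<^bsub>H\<^esub> h) \<triangleright> m = r \<odot>\<^bsub>M\<^esub> (h \<triangleright> m)"
    and act_smult_right: "\<lbrakk>r \<in> carrier R; h \<in> carrier H; m \<in> carrier M\<rbrakk> \<Longrightarrow>
      h \<triangleright> (r \<odot>\<^bsub>M\<^esub> m) = r \<odot>\<^bsub>M\<^esub> (h \<triangleright> m)"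
    and act_mult: "\<lbrakk>h \<in> carrier H; h' \<in> carrier H; m \<in> carrier M\<rbrakk> \<Longrightarrow>
      (h \<otimes>\<^bsub>H\<^esub> h') \<triangleright> m = h \<triangleright> (h' \<triangleright> m)"
    and act_one: "m \<in> carrier M \<Longrightarrow> \<one>\<^bsub>H\<^esub> \<triangleright> m = m"

locale right_comodule = coalgebra R H \<Delta> \<epsilon> + M: module R M
  for R (structure) and H (structure) and \<Delta> and \<epsilon> and M (structure) +
  fixes \<rho> :: "'m \<Rightarrow> ('m, 'h) tensor"
  constrains H :: "('a, 'h, 'u) module_scheme" and M :: "('a, 'm, 'v) module_scheme"
  assumes coact_linear: "\<rho> \<in> module_hom R M (tensor_product R M H)"
    and coact_coassoc: "m \<in> carrier M \<Longrightarrow>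
      tensor_assoc R M H H (tensor_map R M H (tensor_product R M H) H \<rho> id (\<rho> m)) =
      tensor_map R M H M (tensor_product R H H) id \<Delta> (\<rho> m)"
    and coact_counit: "m \<in> carrier M \<Longrightarrow>
      tensor_lift R M H (add_monoid M) (\<lambda>x h. \<epsilon> h \<odot>\<^bsub>M\<^esub> x) (\<rho> m) = m"

locale left_right_dimodule =
  bialgebra R H \<Delta> \<epsilon> + left_module R H M act + right_comodule R H \<Delta> \<epsilon> M \<rho>
  for R (structure) and H (structure) and \<Delta> and \<epsilon> and M (structure)
    and act (infixr \<open>\<triangleright>\<close> 75) and \<rho> +
  assumes dimodule_compat: "\<lbrakk>h \<in> carrier H; m \<in> carrier M\<rbrakk> \<Longrightarrow>
      \<rho> (h \<triangleright> m) = tensor_map R M H M H (\<lambda>x. h \<triangleright> x) id (\<rho> m)"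


section \<open>Rota--Baxter paired comodules\<close>

locale rota_baxter_paired_comodule = right_comodule R H \<Delta> \<epsilon> M \<rho>
  for R (structure) and H (structure) and \<Delta> and \<epsilon> and M (structure) and \<rho> +
  fixes P :: "'h \<Rightarrow> 'h" and T :: "'m \<Rightarrow> 'm" and w :: 'a
  constrains H :: "('a, 'h, 'u) module_scheme" and M :: "('a, 'm, 'v) module_scheme"
  assumes P_linear: "P \<in> module_hom R H H"
    and T_linear: "T \<in> module_hom R M M"
    and weight_closed: "w \<in> carrier R"
    and rota_baxter: "m \<in> carrier M \<Longrightarrow>
      tensor_map R M H M H T P (\<rho> m) =
        tensor_map R M H M H id P (\<rho> (T m))
        \<oplus>\<^bsub>tensor_product R M H\<^esub> tensor_map R M H M H T id (\<rho> (T m))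
        \<oplus>\<^bsub>tensor_product R M H\<^esub> w \<odot>\<^bsub>tensor_product R M H\<^esub> \<rho> (T m)"

definition generic_rota_baxter_paired_comodule where
  "generic_rota_baxter_paired_comodule R H \<Delta> \<epsilon> M \<rho> T w \<longleftrightarrow>
     (\<forall>P \<in> module_hom R H H. rota_baxter_paired_comodule R H \<Delta> \<epsilon> M \<rho> P T w)"

end

theory Submission
  imports Defs
begin

text \<open>
  By the dimodule law, \<open>\<rho> T = (T \<otimes> id) \<rho>\<close>. Hence \<open>(id \<otimes> P) \<rho> T = (T \<otimes> P) \<rho>\<close>, and
  \<open>(T \<otimes> id) \<rho> T = (T\<^sup>2 \<otimes> id) \<rho> = (T \<otimes> id) \<rho> = \<rho> T\<close> because \<open>T\<close> is idempotent, so that this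
  term cancels against \<open>- \<rho> T\<close>.
\<close>

section \<open>Additivity and balancedness of pure tensors\<close>

context
  fixes R :: "('k, 'r) ring_scheme" and A :: "('k, 'a, 'u) module_scheme"
    and B :: "('k, 'b, 'v) module_scheme"
  assumes AB: "module R A" "module R B"
begin

lemma tensor_quotient_hom:
  "(\<lambda>x. tensor_subgroup R A B #>\<^bsub>tensor_free A B\<^esub> x) \<in> hom (tensor_free A B) (tensor_group R A B)"
  unfolding tensor_group_def
  by (rule normal.r_coset_hom_Mod[OF tensor_subgroup_normal[OF AB]])

text \<open>Relators lie in the subgroup they generate, and the coset of a member of the subgroup is
  the subgroup itself, which is the identity of the factor group.\<close>

lemma tensor_quotient_relator:
  assumes "x \<in> tensor_relators R A B"
  shows "tensor_subgroup R A B #>\<^bsub>tensor_free A B\<^esub> x = \<one>\<^bsub>tensor_group R A B\<^esub>"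
proof -
  interpret F: comm_group "tensor_free A B" by (rule abelian_free_Abelian_group)
  interpret N: normal "tensor_subgroup R A B" "tensor_free A B" by (rule tensor_subgroup_normal[OF AB])
  have "x \<in> tensor_subgroup R A B"
    unfolding tensor_subgroup_def using assms by (rule generate.incl)
  then show ?thesis
    using F.coset_join2 N.subset N.subgroup_axioms by (auto simp: tensor_group_def FactGroup_def)
qed

lemma pure_tensor_balanced:
  assumes "r \<in> carrier R" and "a \<in> carrier A" and "b \<in> carrier B"
  shows "pure_tensor R A B (r \<odot>\<^bsub>A\<^esub> a) b = pure_tensor R A B a (r \<odot>\<^bsub>B\<^esub> b)"
proof -
  interpret A: module R A by (rule AB)
  interpret B: module R B by (rule AB)
  interpret T: comm_group "tensor_group R A B" by (rule tensor_group_comm_group[OF AB])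
  let ?q = "\<lambda>x. tensor_subgroup R A B #>\<^bsub>tensor_free A B\<^esub> x"
  have "frag_of (r \<odot>\<^bsub>A\<^esub> a, b) - frag_of (a, r \<odot>\<^bsub>B\<^esub> b) \<in> tensor_relators R A B"
    unfolding tensor_relators_def using assms by blast
  then have "?q (frag_of (r \<odot>\<^bsub>A\<^esub> a, b) - frag_of (a, r \<odot>\<^bsub>B\<^esub> b)) = \<one>\<^bsub>tensor_group R A B\<^esub>"
    by (rule tensor_quotient_relator)
  \<comment> \<open>The quotient map turns the difference into \<open>x\<close> times the inverse of
    \<open>y\<close>; as this is the identity, \<open>x\<close> is the inverse of the inverse of
    \<open>y\<close>.\<close>
  then show ?thesis
    using assms free_Abelian_group_hom_diff[OF tensor_quotient_hom T.is_group,
        of "frag_of (r \<odot>\<^bsub>A\<^esub> a, b)" "frag_of (a, r \<odot>\<^bsub>B\<^esub> b)"]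
      T.inv_equality[of "pure_tensor R A B (r \<odot>\<^bsub>A\<^esub> a) b" "inv\<^bsub>tensor_group R A B\<^esub> pure_tensor R A B a (r \<odot>\<^bsub>B\<^esub> b)"]
    by (simp add: pure_tensor_def[symmetric] pure_tensor_closed[OF AB])
qed

text \<open>Both additivity relators have the shape \<open>p - q - r\<close>, so one argument serves
  the left and the right factor: the quotient map kills the relator and respects
  differences.\<close>

lemma pure_tensor_add:
  assumes "frag_of (a, b) - frag_of (c, d) - frag_of (c', d') \<in> tensor_relators R A B"
    and "a \<in> carrier A" "c \<in> carrier A" "c' \<in> carrier A"
    and "b \<in> carrier B" "d \<in> carrier B" "d' \<in> carrier B"
  shows "pure_tensor R A B a b = pure_tensor R A B c d \<otimes>\<^bsub>tensor_group R A B\<^esub> pure_tensor R A B c' d'"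
proof -
  interpret T: comm_group "tensor_group R A B" by (rule tensor_group_comm_group[OF AB])
  let ?q = "\<lambda>x. tensor_subgroup R A B #>\<^bsub>tensor_free A B\<^esub> x"
  \<comment> \<open>The rule for differences is applied twice; the outer use needs the inner
    difference to be supported on \<open>carrier A \<times> carrier B\<close>.\<close>
  have keys: "Poly_Mapping.keys (frag_of (a, b) - frag_of (c, d)) \<subseteq> carrier A \<times> carrier B"
    using assms keys_diff[of "frag_of (a, b)" "frag_of (c, d)"] by auto
  have pure: "?q (frag_of p) = pure_tensor R A B (fst p) (snd p)" for p
    by (simp add: pure_tensor_def)
  have "pure_tensor R A B a b \<otimes>\<^bsub>tensor_group R A B\<^esub> inv\<^bsub>tensor_group R A B\<^esub> pure_tensor R A B c d
      \<otimes>\<^bsub>tensor_group R A B\<^esub> inv\<^bsub>tensor_group R A B\<^esub> pure_tensor R A B c' d' = \<one>\<^bsub>tensor_group R A B\<^esub>"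
    using assms keys tensor_quotient_relator[OF assms(1)]
      free_Abelian_group_hom_diff[OF tensor_quotient_hom T.is_group]
    by (simp add: pure)
  then show ?thesis
    using assms(2-) pure_tensor_closed[OF AB] T.m_comm
    by (metis T.inv_closed T.inv_solve_right T.l_one T.m_closed T.one_closed)
qed

lemma pure_tensor_add_left:
  assumes "a \<in> carrier A" and "a' \<in> carrier A" and "b \<in> carrier B"
  shows "pure_tensor R A B (a \<oplus>\<^bsub>A\<^esub> a') b =
    pure_tensor R A B a b \<otimes>\<^bsub>tensor_group R A B\<^esub> pure_tensor R A B a' b"
proof -
  interpret A: module R A by (rule AB)
  show ?thesis
    by (rule pure_tensor_add) (use assms in \<open>auto simp: tensor_relators_def\<close>)
qed

lemma pure_tensor_add_right:
  assumes "a \<in> carrier A" and "b \<in> carrier B" and "b' \<in> carrier B"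
  shows "pure_tensor R A B a (b \<oplus>\<^bsub>B\<^esub> b') =
    pure_tensor R A B a b \<otimes>\<^bsub>tensor_group R A B\<^esub> pure_tensor R A B a b'"
proof -
  interpret B: module R B by (rule AB)
  show ?thesis
    by (rule pure_tensor_add) (use assms in \<open>auto simp: tensor_relators_def\<close>)
qed

end

section \<open>Functoriality of the tensor product\<close>

context
  fixes R :: "('k, 'r) ring_scheme" and A :: "('k, 'a, 'u) module_scheme"
    and B :: "('k, 'b, 'v) module_scheme" and A' :: "('k, 'c, 'w) module_scheme"
    and B' :: "('k, 'd, 'x) module_scheme"
    and f :: "'a \<Rightarrow> 'c" and g :: "'b \<Rightarrow> 'd"
  assumes AB: "module R A" "module R B" and AB': "module R A'" "module R B'"
    and f: "f \<in> module_hom R A A'" and g: "g \<in> module_hom R B B'"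
begin

text \<open>Linearity of \<open>f\<close> and \<open>g\<close> makes the pure tensor of
  \<open>f a\<close> and \<open>g b\<close> biadditive and balanced in \<open>a\<close> and
  \<open>b\<close>, so the universal property supplies the map.\<close>

lemma tensor_map_hom: "tensor_map R A B A' B' f g \<in> hom (tensor_group R A B) (tensor_group R A' B')"
  unfolding tensor_map_def using f g
  by (intro tensor_lift_hom AB tensor_group_comm_group AB')
    (simp_all add: module_hom_def Pi_iff pure_tensor_closed[OF AB'] pure_tensor_add_left[OF AB']
      pure_tensor_add_right[OF AB'] pure_tensor_balanced[OF AB'])

lemma tensor_map_pure:
  assumes "a \<in> carrier A" and "b \<in> carrier B"
  shows "tensor_map R A B A' B' f g (pure_tensor R A B a b) = pure_tensor R A' B' (f a) (g b)"
  unfolding tensor_map_def using f g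
  by (intro tensor_lift_pure AB tensor_group_comm_group AB' assms)
    (simp_all add: module_hom_def Pi_iff pure_tensor_closed[OF AB'] pure_tensor_add_left[OF AB']
      pure_tensor_add_right[OF AB'] pure_tensor_balanced[OF AB'])

end

text \<open>Pure tensors determine an additive map, and only arguments in the carriers enter them.
  This matters because \<open>T\<close> and \<open>act e\<close>, or \<open>T \<circ> T\<close> and
  \<open>T\<close>, are only known to agree on \<open>carrier M\<close>.\<close>

lemma tensor_map_cong:
  assumes AB: "module R A" "module R B" and AB': "module R A'" "module R B'"
    and f: "f \<in> module_hom R A A'" and g: "g \<in> module_hom R B B'"
    and f': "f' \<in> module_hom R A A'" and g': "g' \<in> module_hom R B B'"
    and eq: "\<And>a. a \<in> carrier A \<Longrightarrow> f a = f' a" "\<And>b. b \<in> carrier B \<Longrightarrow> g b = g' b"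
    and t: "t \<in> carrier (tensor_group R A B)"
  shows "tensor_map R A B A' B' f g t = tensor_map R A B A' B' f' g' t"
proof (rule tensor_hom_unique[OF AB _ _ _ _ t])
  show "group (tensor_group R A' B')"
    using tensor_group_comm_group[OF AB'] by (simp add: comm_group_def)
qed (auto intro!: tensor_map_hom[OF AB AB'] simp: tensor_map_pure[OF AB AB'] f g f' g' eq)

lemma module_hom_comp:
  assumes "f \<in> module_hom R A B" and "g \<in> module_hom R B C"
  shows "g \<circ> f \<in> module_hom R A C"
  using assms by (auto simp: module_hom_def Pi_iff)

lemma id_module_hom: "id \<in> module_hom R A A"
  by (auto simp: module_hom_def)

text \<open>Both sides are additive in \<open>t\<close> and send the pure tensor of \<open>a\<close>
  and \<open>b\<close> to that of \<open>f' (f a)\<close> and \<open>g' (g b)\<close>.\<close>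

lemma tensor_map_comp:
  assumes AB: "module R A" "module R B" and AB': "module R A'" "module R B'"
    and AB'': "module R A''" "module R B''"
    and f: "f \<in> module_hom R A A'" and g: "g \<in> module_hom R B B'"
    and f': "f' \<in> module_hom R A' A''" and g': "g' \<in> module_hom R B' B''"
    and t: "t \<in> carrier (tensor_group R A B)"
  shows "tensor_map R A' B' A'' B'' f' g' (tensor_map R A B A' B' f g t) =
    tensor_map R A B A'' B'' (f' \<circ> f) (g' \<circ> g) t"
proof -
  note fc = module_hom_comp[OF f f'] and gc = module_hom_comp[OF g g']
  have "(tensor_map R A' B' A'' B'' f' g' \<circ> tensor_map R A B A' B' f g) t =
      tensor_map R A B A'' B'' (f' \<circ> f) (g' \<circ> g) t"
  proof (rule tensor_hom_unique[OF AB _ _ _ _ t])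
    show "group (tensor_group R A'' B'')"
      using tensor_group_comm_group[OF AB''] by (simp add: comm_group_def)
    show "tensor_map R A' B' A'' B'' f' g' \<circ> tensor_map R A B A' B' f g
        \<in> hom (tensor_group R A B) (tensor_group R A'' B'')"
      by (rule Group.hom_compose[OF tensor_map_hom[OF AB AB' f g] tensor_map_hom[OF AB' AB'' f' g']])
    show "tensor_map R A B A'' B'' (f' \<circ> f) (g' \<circ> g)
        \<in> hom (tensor_group R A B) (tensor_group R A'' B'')"
      by (rule tensor_map_hom[OF AB AB'' fc gc])
    fix a b assume ab: "a \<in> carrier A" "b \<in> carrier B"
    then have "f a \<in> carrier A'" "g b \<in> carrier B'" using f g by (auto simp: module_hom_def)
    then show "(tensor_map R A' B' A'' B'' f' g' \<circ> tensor_map R A B A' B' f g) (pure_tensor R A B a b) =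
        tensor_map R A B A'' B'' (f' \<circ> f) (g' \<circ> g) (pure_tensor R A B a b)"
      using ab by (simp add: tensor_map_pure[OF AB AB' f g] tensor_map_pure[OF AB' AB'' f' g']
          tensor_map_pure[OF AB AB'' fc gc])
  qed
  then show ?thesis by simp
qed

section \<open>Scalar multiplication on the tensor product\<close>

text \<open>Both sides unfold to the same lift. In this form, scaling inherits the facts about
  \<open>tensor_map\<close>.\<close>

lemma tensor_product_smult_eq_tensor_map:
  "r \<odot>\<^bsub>tensor_product R A B\<^esub> t = tensor_map R A B A B (\<lambda>a. r \<odot>\<^bsub>A\<^esub> a) id t"
  by (simp add: tensor_product_def tensor_map_def)

text \<open>Compatibility with scalars rests on the commutativity of \<open>R\<close>.\<close>

lemma smult_module_hom:
  assumes "module R A" and "r \<in> carrier R"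
  shows "(\<lambda>a. r \<odot>\<^bsub>A\<^esub> a) \<in> module_hom R A A"
proof -
  interpret module R A by fact
  show ?thesis
    using assms(2) by (auto simp: module_hom_def smult_r_distr smult_assoc1[symmetric] m_comm)
qed

text \<open>On a pure tensor, the scalar moves into the first factor, where \<open>a\<close> and its
  negative add up to zero. Additivity in \<open>t\<close> extends this to all tensors. The
  right-hand side is the zero tensor, as \<open>tensor_group\<close> is written
  multiplicatively.\<close>

lemma tensor_product_add_smult_minus_one:
  assumes AB: "module R A" "module R B" and t: "t \<in> carrier (tensor_group R A B)"
  shows "t \<oplus>\<^bsub>tensor_product R A B\<^esub> (\<ominus>\<^bsub>R\<^esub> \<one>\<^bsub>R\<^esub>) \<odot>\<^bsub>tensor_product R A B\<^esub> t = \<one>\<^bsub>tensor_group R A B\<^esub>"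
proof -
  interpret A: module R A by (rule AB)
  interpret B: module R B by (rule AB)
  interpret T: comm_group "tensor_group R A B" by (rule tensor_group_comm_group[OF AB])
  let ?n = "tensor_map R A B A B (\<lambda>a. (\<ominus>\<^bsub>R\<^esub> \<one>\<^bsub>R\<^esub>) \<odot>\<^bsub>A\<^esub> a) id"
  have s: "(\<lambda>a. (\<ominus>\<^bsub>R\<^esub> \<one>\<^bsub>R\<^esub>) \<odot>\<^bsub>A\<^esub> a) \<in> module_hom R A A"
    by (rule smult_module_hom[OF AB(1)]) simp
  note n = tensor_map_hom[OF AB AB s id_module_hom]
  \<comment> \<open>Splitting zero as zero plus zero shows that this tensor equals its own double,
    so it cancels.\<close>
  have pure0: "pure_tensor R A B \<zero>\<^bsub>A\<^esub> b = \<one>\<^bsub>tensor_group R A B\<^esub>" if "b \<in> carrier B" for b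
    using that pure_tensor_add_left[OF AB A.zero_closed A.zero_closed that]
      pure_tensor_closed[OF AB A.zero_closed that]
    by (metis A.l_zero A.zero_closed T.r_cancel_one')
  \<comment> \<open>The identity is read as an equality of two homomorphisms, the second one
    trivial; that the first is one uses commutativity of the group.\<close>
  have "t \<otimes>\<^bsub>tensor_group R A B\<^esub> ?n t = (\<lambda>_. \<one>\<^bsub>tensor_group R A B\<^esub>) t"
  proof (rule tensor_hom_unique[OF AB T.is_group _ _ _ t])
    show "(\<lambda>t. t \<otimes>\<^bsub>tensor_group R A B\<^esub> ?n t) \<in> hom (tensor_group R A B) (tensor_group R A B)"
      using n by (auto simp: hom_def Pi_iff T.m_ac)
    show "(\<lambda>_. \<one>\<^bsub>tensor_group R A B\<^esub>) \<in> hom (tensor_group R A B) (tensor_group R A B)"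
      by (simp add: hom_def)
    fix a b assume ab: "a \<in> carrier A" "b \<in> carrier B"
    have "a \<oplus>\<^bsub>A\<^esub> (\<ominus>\<^bsub>R\<^esub> \<one>\<^bsub>R\<^esub>) \<odot>\<^bsub>A\<^esub> a = \<zero>\<^bsub>A\<^esub>"
      using ab by (simp add: A.smult_l_minus A.M.r_neg)
    then show "pure_tensor R A B a b \<otimes>\<^bsub>tensor_group R A B\<^esub> ?n (pure_tensor R A B a b) =
        \<one>\<^bsub>tensor_group R A B\<^esub>"
      using ab pure0[of b] pure_tensor_add_left[OF AB, of a "(\<ominus>\<^bsub>R\<^esub> \<one>\<^bsub>R\<^esub>) \<odot>\<^bsub>A\<^esub> a" b]
      by (simp add: tensor_map_pure[OF AB AB s id_module_hom])
  qed
  then show ?thesis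
    unfolding tensor_product_smult_eq_tensor_map by (simp add: tensor_product_def)
qed

section \<open>The action of an idempotent on a dimodule\<close>

theorem proposition4p10:
  fixes R :: "('k, 'r) ring_scheme"
    and H :: "('k, 'h, 'u) module_scheme"
    and M :: "('k, 'm, 'v) module_scheme"
    and \<Delta> :: "'h \<Rightarrow> ('h, 'h) tensor"
    and \<epsilon> :: "'h \<Rightarrow> 'k"
    and act :: "'h \<Rightarrow> 'm \<Rightarrow> 'm"
    and \<rho> :: "'m \<Rightarrow> ('m, 'h) tensor"
    and e :: 'h
    and T :: "'m \<Rightarrow> 'm"
  assumes "field R"
    and "bialgebra R H \<Delta> \<epsilon>"
    and "e \<in> carrier H" and "e \<otimes>\<^bsub>H\<^esub> e = e"
    and "left_right_dimodule R H \<Delta> \<epsilon> M act \<rho>"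
    and "\<And>m. m \<in> carrier M \<Longrightarrow> T m = act e m"
  shows "generic_rota_baxter_paired_comodule R H \<Delta> \<epsilon> M \<rho> T (\<ominus>\<^bsub>R\<^esub> \<one>\<^bsub>R\<^esub>)"
proof -
  interpret D: left_right_dimodule R H \<Delta> \<epsilon> M act \<rho> by fact
  note MH = D.M.module_axioms D.module_axioms
  let ?G = "tensor_group R M H"
  interpret G: comm_group ?G by (rule tensor_group_comm_group[OF MH])
  have T: "T \<in> module_hom R M M"
    using assms(3,6) by (auto simp: module_hom_def D.act_closed D.act_add_right D.act_smult_right)
  have act: "act e \<in> module_hom R M M"
    using assms(3) by (auto simp: module_hom_def D.act_closed D.act_add_right D.act_smult_right)
  \<comment> \<open>This is where \<open>e\<close> being idempotent enters, through
    \<open>act_mult\<close>.\<close>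
  have TT: "T (T m) = T m" if "m \<in> carrier M" for m
    using that assms(3,4,6) D.act_mult[of e e m] by (simp add: D.act_closed)
  have closed: "\<rho> m \<in> carrier ?G" if "m \<in> carrier M" for m
    using that D.coact_linear by (auto simp: module_hom_def tensor_product_def)
  \<comment> \<open>The dimodule law speaks of \<open>act e\<close>; passing to \<open>T\<close> is
    a congruence on \<open>carrier M\<close>.\<close>
  have coact_T: "\<rho> (T m) = tensor_map R M H M H T id (\<rho> m)" if m: "m \<in> carrier M" for m
  proof -
    have "\<rho> (T m) = tensor_map R M H M H (act e) id (\<rho> m)"
      using m assms(3,6) by (simp add: D.dimodule_compat)
    also have "\<dots> = tensor_map R M H M H T id (\<rho> m)"
      by (rule tensor_map_cong[OF MH MH act id_module_hom T id_module_hom _ _ closed[OF m]])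
        (simp_all add: assms(6))
    finally show ?thesis .
  qed
  show ?thesis
    unfolding generic_rota_baxter_paired_comodule_def
  proof
    fix P assume P: "P \<in> module_hom R H H"
    show "rota_baxter_paired_comodule R H \<Delta> \<epsilon> M \<rho> P T (\<ominus>\<^bsub>R\<^esub> \<one>\<^bsub>R\<^esub>)"
    \<comment> \<open>The comodule axioms come from \<open>D\<close>. Linearity of \<open>P\<close>
      and \<open>T\<close> and membership of the weight in \<open>R\<close> are settled at the
      end.\<close>
    proof
      fix m assume m: "m \<in> carrier M"
      then have Tm: "T m \<in> carrier M" using T by (auto simp: module_hom_def)
      \<comment> \<open>The inner map is fixed as \<open>T\<close> tensor \<open>id\<close>, which
        produces \<open>\<rho> (T m)\<close> from \<open>\<rho> m\<close>; the outer map stays free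
        for the two uses below.\<close>
      note comp = tensor_map_comp[OF MH MH MH T id_module_hom _ _ closed[OF m]]
      have 1: "tensor_map R M H M H id P (\<rho> (T m)) = tensor_map R M H M H T P (\<rho> m)"
        using comp[OF id_module_hom P] by (simp add: coact_T[OF m])
      have "tensor_map R M H M H T id (\<rho> (T m)) = tensor_map R M H M H (T \<circ> T) id (\<rho> m)"
        using comp[OF T id_module_hom] by (simp add: coact_T[OF m])
      also have "\<dots> = \<rho> (T m)"
        unfolding coact_T[OF m]
        by (rule tensor_map_cong[OF MH MH module_hom_comp[OF T T] id_module_hom T id_module_hom
              _ _ closed[OF m]]) (simp_all add: TT)
      finally have 2: "tensor_map R M H M H T id (\<rho> (T m)) = \<rho> (T m)" .
      have c: "tensor_map R M H M H T P (\<rho> m) \<in> carrier ?G"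
        using tensor_map_hom[OF MH MH T P] closed[OF m] by (auto simp: hom_def)
      have n: "(\<ominus>\<^bsub>R\<^esub> \<one>\<^bsub>R\<^esub>) \<odot>\<^bsub>tensor_product R M H\<^esub> \<rho> (T m) \<in> carrier ?G"
        unfolding tensor_product_smult_eq_tensor_map
        using tensor_map_hom[OF MH MH smult_module_hom[OF MH(1)] id_module_hom] closed[OF Tm]
        by (simp add: hom_def Pi_iff)
      have add: "x \<oplus>\<^bsub>tensor_product R M H\<^esub> y = x \<otimes>\<^bsub>?G\<^esub> y" for x y
        by (simp add: tensor_product_def)
      show "tensor_map R M H M H T P (\<rho> m) =
          tensor_map R M H M H id P (\<rho> (T m))
          \<oplus>\<^bsub>tensor_product R M H\<^esub> tensor_map R M H M H T id (\<rho> (T m))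
          \<oplus>\<^bsub>tensor_product R M H\<^esub> (\<ominus>\<^bsub>R\<^esub> \<one>\<^bsub>R\<^esub>) \<odot>\<^bsub>tensor_product R M H\<^esub> \<rho> (T m)"
        \<comment> \<open>By \<open>1\<close> and \<open>2\<close> the right-hand side is the
          left-hand side plus \<open>\<rho> (T m)\<close> plus its multiple by minus one.
          Associativity, for which \<open>c\<close> and \<open>n\<close> give closure, groups the
          last two terms, and their sum is zero.\<close>
        using tensor_product_add_smult_minus_one[OF MH closed[OF Tm]] c n closed[OF Tm]
        by (simp add: 1 2 add G.m_assoc)
    qed (use P T in simp_all)
  qed
qed

end
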